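(* Let $\{v_i\}_{i=1}^k$ be a tight frame for $\mathbb{R}^n$ with frame bound $A$. Append $p$ vectors $v_{k+1},v_{k+2},\dots,v_{k+p}$ of $\mathbb{R}^n$, obtaining $\{v_i\}_{i=1}^{k+p}$. Then $\{v_i\}_{i=1}^{k+p}$ is a tight frame for $\mathbb{R}^n$ if and only if $\{v_i\}_{i=k+1}^{k+p}$ is a tight frame for $\mathbb{R}^n$.
   Context: A finite family $\{x_j\}_{j\in J}$ of vectors in $\mathbb{R}^n$ is a tight frame with frame bound $A$, where $0<A<\infty$, if $\sum_{j\in J}|\langle x,x_j\rangle|^2=A\|x\|^2$ for all $x\in\mathbb{R}^n$.
   Formalization: The formal statement additionally assumes that at least one appended vector is nonzero; if all are zero (or p = 0), the enlarged family is still a tight frame, but the appended family is not, since its frame bound would have to be 0. *)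

theory Defs
  imports "HOL-Analysis.Analysis"
begin

definition tight_frame_bound :: "'j set \<Rightarrow> ('j \<Rightarrow> real ^ 'n) \<Rightarrow> real \<Rightarrow> bool" where
  "tight_frame_bound J x A \<longleftrightarrow>
     finite J \<and> 0 < A \<and> (\<forall>y. (\<Sum>j\<in>J. \<bar>y \<bullet> x j\<bar>\<^sup>2) = A * (norm y)\<^sup>2)"

(* The bound must be strictly positive, so a family consisting only of zero vectors
   (in particular the empty family) is not a tight frame. *)
definition tight_frame :: "'j set \<Rightarrow> ('j \<Rightarrow> real ^ 'n) \<Rightarrow> bool" where
  "tight_frame J x \<longleftrightarrow> (\<exists>A. tight_frame_bound J x A)"

end

theory Submission imports Defs begin

text \<open>For disjoint index sets the sums of squared inner products add, so frame bounds add over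
  a union (\<open>tight_frame_bound_Un\<close>) and subtract when one part is removed
  (\<open>tight_frame_bound_Diff\<close>). Only the subtracted bound \<open>B - A\<close> needs
  care: it must be strictly positive.\<close>

lemma tight_frame_bound_Un:
  assumes "tight_frame_bound I x A" "tight_frame_bound J x B" "I \<inter> J = {}"
  shows "tight_frame_bound (I \<union> J) x (A + B)"
  using assms by (auto simp: tight_frame_bound_def sum.union_disjoint distrib_right)

text \<open>The identity for \<open>J\<close> comes from subtraction alone; \<open>nz\<close> serves
  to exclude \<open>B = A\<close>, where every vector of \<open>J\<close> would vanish.\<close>

lemma tight_frame_bound_Diff:
  assumes I: "tight_frame_bound I x A" and IJ: "tight_frame_bound (I \<union> J) x B"
    and disj: "I \<inter> J = {}" and nz: "\<exists>j\<in>J. x j \<noteq> 0"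
  shows "tight_frame_bound J x (B - A)"
proof -
  have fin: "finite I" "finite J"
    using IJ by (auto simp: tight_frame_bound_def)
  have eq: "(\<Sum>j\<in>J. \<bar>y \<bullet> x j\<bar>\<^sup>2) = (B - A) * (norm y)\<^sup>2" for y
  proof -
    have "(\<Sum>j\<in>I \<union> J. \<bar>y \<bullet> x j\<bar>\<^sup>2) = (\<Sum>j\<in>I. \<bar>y \<bullet> x j\<bar>\<^sup>2) + (\<Sum>j\<in>J. \<bar>y \<bullet> x j\<bar>\<^sup>2)"
      using fin disj by (rule sum.union_disjoint)
    moreover have "(\<Sum>j\<in>I \<union> J. \<bar>y \<bullet> x j\<bar>\<^sup>2) = B * (norm y)\<^sup>2"
      using IJ by (simp only: tight_frame_bound_def)
    moreover have "(\<Sum>j\<in>I. \<bar>y \<bullet> x j\<bar>\<^sup>2) = A * (norm y)\<^sup>2"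
      using I by (simp only: tight_frame_bound_def)
    ultimately show ?thesis
      by (simp add: left_diff_distrib)
  qed
  obtain i where i: "i \<in> J" "x i \<noteq> 0"
    using nz by blast
  \<comment> \<open>Test the identity at the nonzero vector \<open>x i\<close> itself: the term
    \<open>j = i\<close> is the fourth power of its norm, and no term is negative.\<close>
  have "0 < (\<Sum>j\<in>J. \<bar>x i \<bullet> x j\<bar>\<^sup>2)"
    using fin(2) i by (intro sum_pos2[of J i]) auto
  then have "0 < B - A"
    unfolding eq using i(2) by (simp add: zero_less_mult_iff)
  with fin(2) eq show ?thesis
    by (simp add: tight_frame_bound_def)
qed

text \<open>The second assumption rules out appending only zero vectors (or none,
  \<open>p = 0\<close>): the extended family would stay tight with bound \<open>A\<close>, while the
  appended one would have bound 0.\<close>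

theorem proposition4p2:
  fixes v :: "nat \<Rightarrow> real ^ 'n" and k p :: nat and A :: real
  assumes "tight_frame_bound {1..k} v A"
    and "\<exists>i\<in>{k+1..k+p}. v i \<noteq> 0"
  shows "tight_frame {1..k+p} v \<longleftrightarrow> tight_frame {k+1..k+p} v"
proof -
  have union: "{1..k+p} = {1..k} \<union> {k+1..k+p}" and disj: "{1..k} \<inter> {k+1..k+p} = {}"
    by auto
  show ?thesis
    unfolding tight_frame_def union
    using tight_frame_bound_Un[OF assms(1) _ disj]
      tight_frame_bound_Diff[OF assms(1) _ disj assms(2)]
    by blast
qed

end
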